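(* For every integer $n\ge 1$, $$\mathrm{pf}_n(132,231)=\sum_{k=0}^{n-1}\binom{n-1}{k}C_{n-k},$$ where $C_j=\frac{1}{j+1}\binom{2j}{j}$ is the $j$th Catalan number.
   Context: A Dyck path of semilength $n$ is a lattice path from $(0,0)$ to $(n,n)$ consisting of $n$ north steps $N=(0,1)$ and $n$ east steps $E=(1,0)$ that never goes below the line $y=x$. A parking function of size $n$ is a Dyck path of semilength $n$ whose $n$ north steps are labeled bijectively by $\{1,\dots,n\}$ so that whenever two north steps are consecutive in the path (one immediately following the other), the label of the later one is larger. For a parking function $p$ of size $n$, $\phi(p)$ is the permutation of $\{1,\dots,n\}$ (in one-line notation) obtained by reading the labels of the north steps in the order they occur along the path. A permutation $\pi$ of $\{1,\dots,n\}$ contains a permutation $\rho$ of $\{1,\dots,m\}$ if there are indices $1\le i_1<\cdots<i_m\le n$ such that $\pi_{i_a}\le\pi_{i_b}$ if and only if $\rho_a\le\rho_b$; otherwise $\pi$ avoids $\rho$. For permutations $\rho_1,\dots,\rho_r$, $\mathrm{pf}_n(\rho_1,\dots,\rho_r)$ denotes the number of parking functions $p$ of size $n$ such that $\phi(p)$ avoids each of $\rho_1,\dots,\rho_r$. *)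

theory Defs
  imports Complex_Main "HOL-Combinatorics.Multiset_Permutations"
begin

text \<open>
  A lattice path starting at the origin is the list of its steps, and a label is attached
  to each north step. An unlabelled path is the case \<open>unit step list\<close>.
\<close>

datatype 'a step = North 'a | East

fun is_north :: "'a step \<Rightarrow> bool" where
  "is_north (North l) = True"
| "is_north East = False"

definition endpoint :: "'a step list \<Rightarrow> nat \<times> nat" where
  "endpoint w = (length (filter (\<lambda>s. \<not> is_north s) w), length (filter is_north w))"

text \<open>
  A segment lies weakly above the line \<open>y = x\<close> if both of its ends do, so it is enough to
  look at the lattice points visited by the path.
\<close>

definition dyck_path :: "nat \<Rightarrow> 'a step list \<Rightarrow> bool" where
  "dyck_path n w \<longleftrightarrow>
     endpoint w = (n, n) \<and>
     (\<forall>i \<le> length w. fst (endpoint (take i w)) \<le> snd (endpoint (take i w)))"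

text \<open>The labels of the north steps in path order; on parking functions this is \<open>\<phi>\<close>.\<close>

fun labels :: "'a step list \<Rightarrow> 'a list" where
  "labels [] = []"
| "labels (North l # w) = l # labels w"
| "labels (East # w) = labels w"

definition parking_function :: "nat \<Rightarrow> nat step list \<Rightarrow> bool" where
  "parking_function n p \<longleftrightarrow>
     dyck_path n p \<and>
     labels p \<in> permutations_of_set {1..n} \<and>
     (\<forall>i a b. Suc i < length p \<longrightarrow> p ! i = North a \<longrightarrow> p ! Suc i = North b \<longrightarrow> a < b)"

text \<open>
  Permutations are in one-line notation; the positions \<open>i\<^sub>1 < \<dots> < i\<^sub>m\<close> are counted from 0.
\<close>

definition contains_pattern :: "nat list \<Rightarrow> nat list \<Rightarrow> bool" where
  "contains_pattern \<pi> \<rho> \<longleftrightarrow>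
     (\<exists>i :: nat \<Rightarrow> nat.
        strict_mono_on {..<length \<rho>} i \<and>
        i ` {..<length \<rho>} \<subseteq> {..<length \<pi>} \<and>
        (\<forall>a < length \<rho>. \<forall>b < length \<rho>. \<pi> ! i a \<le> \<pi> ! i b \<longleftrightarrow> \<rho> ! a \<le> \<rho> ! b))"

abbreviation avoids :: "nat list \<Rightarrow> nat list \<Rightarrow> bool" where
  "avoids \<pi> \<rho> \<equiv> \<not> contains_pattern \<pi> \<rho>"

definition pf :: "nat \<Rightarrow> nat list set \<Rightarrow> nat" where
  "pf n R = card {p. parking_function n p \<and> (\<forall>\<rho> \<in> R. avoids (labels p) \<rho>)}"

definition catalan :: "nat \<Rightarrow> real" where
  "catalan j = 1 / (real j + 1) * real ((2 * j) choose j)"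

end

theory Submission
  imports Defs
begin

text \<open>
  Avoiding 132 and 231 means that no entry exceeds both an earlier and a later one, so the
  labels decrease down to 1 and increase afterwards. Each of the \<open>k\<close> descents forces an east
  step, and as the path stays above the diagonal it must begin with \<open>(NE)\<^sup>k\<close>; what follows is an
  arbitrary Dyck path of semilength \<open>n - k\<close>. The labels preceding 1 form an arbitrary
  \<open>k\<close>-subset of \<open>{2..n}\<close>, and the two choices are independent.
\<close>

section \<open>Ballot paths\<close>

text \<open>The prefix condition of \<open>dyck_path\<close>, split off from the endpoint so that
  inductions may pass through paths that end off the diagonal.\<close>

definition ballot :: "'a step list \<Rightarrow> bool" where
  "ballot w \<longleftrightarrow> (\<forall>i \<le> length w. fst (endpoint (take i w)) \<le> snd (endpoint (take i w)))"

lemma endpoint_simps [simp]: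
  "endpoint [] = (0, 0)"
  "endpoint (North a # w) = (fst (endpoint w), Suc (snd (endpoint w)))"
  "endpoint (East # w) = (Suc (fst (endpoint w)), snd (endpoint w))"
  by (simp_all add: endpoint_def)

lemma endpoint_snoc [simp]:
  "endpoint (w @ [North a]) = (fst (endpoint w), Suc (snd (endpoint w)))"
  "endpoint (w @ [East]) = (Suc (fst (endpoint w)), snd (endpoint w))"
  by (simp_all add: endpoint_def)

lemma ballot_Nil [simp]: "ballot []"
  by (simp add: ballot_def)

lemma ballot_snoc:
  "ballot (w @ [s]) \<longleftrightarrow> ballot w \<and> fst (endpoint (w @ [s])) \<le> snd (endpoint (w @ [s]))"
proof -
  have "(\<forall>i \<le> length (w @ [s]). P i) \<longleftrightarrow> (\<forall>i \<le> length w. P i) \<and> P (length (w @ [s]))" for P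
    by (auto simp: le_Suc_eq)
  then show ?thesis
    unfolding ballot_def by simp
qed

lemma ballot_endpoint: "ballot w \<Longrightarrow> fst (endpoint w) \<le> snd (endpoint w)"
  unfolding ballot_def by (metis order_refl take_all)

lemma not_ballot_East [simp]: "\<not> ballot (East # w)"
proof
  assume "ballot (East # w)"
  from this[unfolded ballot_def, rule_format, of 1] show False by simp
qed

text \<open>After one north and one east step the path is back on the diagonal, so the rest faces
  the same condition as a path from the origin.\<close>

lemma ballot_North_East [simp]: "ballot (North a # East # w) \<longleftrightarrow> ballot w"
proof
  assume L: "ballot (North a # East # w)"
  show "ballot w"
    unfolding ballot_def
  proof (intro allI impI)
    fix i assume "i \<le> length w"
    then show "fst (endpoint (take i w)) \<le> snd (endpoint (take i w))"
      using L[unfolded ballot_def, rule_format, of "Suc (Suc i)"] by simp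
  qed
next
  assume R: "ballot w"
  show "ballot (North a # East # w)"
    unfolding ballot_def
  proof (intro allI impI)
    fix i assume i: "i \<le> length (North a # East # w)"
    \<comment> \<open>Lengths 0 and 1 end inside the added peak; a longer prefix is one of
      \<open>w\<close> of length \<open>i - 2\<close> with both coordinates raised by one.\<close>
    consider "i = 0" | "i = 1" | j where "i = Suc (Suc j)"
      by (metis One_nat_def not0_implies_Suc)
    then show "fst (endpoint (take i (North a # East # w)))
        \<le> snd (endpoint (take i (North a # East # w)))"
      using i R[unfolded ballot_def, rule_format, of "i - 2"] by cases simp_all
  qed
qed

lemma dyck_path_iff: "dyck_path n w \<longleftrightarrow> endpoint w = (n, n) \<and> ballot w"
  by (simp add: dyck_path_def ballot_def)

section \<open>Ballot numbers and Catalan numbers\<close>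

definition ballot_words :: "nat \<Rightarrow> nat \<Rightarrow> unit step list set" where
  "ballot_words n e = {w. endpoint w = (e, n) \<and> ballot w}"

lemma ballot_words_0: "ballot_words n 0 = {replicate n (North ())}"
proof -
  have "w = replicate n (North ())" if "endpoint w = (0, n)" for w :: "unit step list"
    using that
  proof (induction w arbitrary: n)
    case (Cons s w)
    then show ?case by (cases s) (auto simp: prod_eq_iff)
  qed simp
  moreover have "endpoint (replicate n (North ())) = (0, n)" for n
    by (induction n) auto
  ultimately show ?thesis
    by (auto simp: ballot_words_def ballot_def)
qed

lemma ballot_words_empty: "n < e \<Longrightarrow> ballot_words n e = {}"
  by (auto simp: ballot_words_def dest: ballot_endpoint)

text \<open>Words are sorted by their last step. The arguments count north steps first and east
  steps second, the reverse of \<open>endpoint\<close>. By the assumption the endpoint lies weakly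
  above the diagonal, so the inequality that \<open>ballot_snoc\<close> adds for the whole word
  holds automatically.\<close>

lemma ballot_words_Suc:
  assumes "e \<le> n"
  shows "ballot_words (Suc n) (Suc e) =
    (\<lambda>w. w @ [North ()]) ` ballot_words n (Suc e) \<union> (\<lambda>w. w @ [East]) ` ballot_words (Suc n) e"
    (is "?L = ?R")
proof
  show "?L \<subseteq> ?R"
  proof
    fix w assume w: "w \<in> ?L"
    then obtain v s where vs: "w = v @ [s]"
      by (cases w rule: rev_cases) (auto simp: ballot_words_def)
    show "w \<in> ?R"
      using w unfolding vs
      by (cases s) (auto simp: ballot_words_def ballot_snoc prod_eq_iff)
  qed
  show "?R \<subseteq> ?L"
    using assms by (auto simp: ballot_words_def ballot_snoc)
qed

text \<open>The boundary case \<open>e = n + 1\<close>, where there are no words, keeps the recursion uniform.\<close>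

lemma card_ballot_words:
  "e \<le> Suc n \<Longrightarrow>
    finite (ballot_words n e) \<and> card (ballot_words n e) + ((n + e) choose Suc n) = (n + e) choose e"
proof (induction "n + e" arbitrary: n e rule: less_induct)
  case less
  show ?case
  proof (cases e)
    case 0
    then show ?thesis by (simp add: ballot_words_0)
  next
    case e: (Suc e')
    show ?thesis
    proof (cases "e \<le> n")
      case False
      then have "e = Suc n" using less.prems by simp
      then show ?thesis by (simp add: ballot_words_empty)
    next
      case True
      then obtain n' where n: "n = Suc n'" using e by (cases n) auto
      have a: "finite (ballot_words n' (Suc e'))"
        "card (ballot_words n' (Suc e')) + ((n' + Suc e') choose Suc n') = (n' + Suc e') choose Suc e'"
        using less.hyps[of n' "Suc e'"] True e n by auto
      have b: "finite (ballot_words (Suc n') e')"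
        "card (ballot_words (Suc n') e') + ((Suc n' + e') choose Suc (Suc n')) = (Suc n' + e') choose e'"
        using less.hyps[of "Suc n'" e'] True e n by auto
      \<comment> \<open>The two images are disjoint, since their words end in different steps, and
        appending a fixed step is injective.\<close>
      have "card (ballot_words n e) =
          card (ballot_words n' (Suc e')) + card (ballot_words (Suc n') e')"
        using True e n a(1) b(1)
        by (subst n, subst e, subst ballot_words_Suc, simp, subst card_Un_disjoint)
           (auto simp: card_image inj_on_def)
      moreover have "finite (ballot_words n e)"
        using True e n a(1) b(1) by (simp add: ballot_words_Suc)
      \<comment> \<open>Adding \<open>a(2)\<close> and \<open>b(2)\<close>, Pascal's rule merges the
        binomials on each side.\<close>
      ultimately show ?thesis
        using a(2) b(2) e n by simp
    qed
  qed
qed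

lemma finite_dyck_words: "finite (ballot_words n n)"
  using card_ballot_words[of n n] by simp

text \<open>The diagonal case of the reflection formula C(n+e, e) - C(n+e, n+1), turned into the
  closed form of the Catalan number.\<close>

lemma card_dyck_words: "real (card (ballot_words n n)) = catalan n"
proof -
  have "real (card (ballot_words n n)) = real ((2 * n) choose n) - real ((2 * n) choose Suc n)"
    using card_ballot_words[of n n] by (simp add: mult_2 eq_diff_eq flip: of_nat_add)
  \<comment> \<open>Multiplied by n + 1, the subtracted binomial becomes n C(2n, n), so the
    difference collapses to C(2n, n).\<close>
  moreover have "(real n + 1) * real ((2 * n) choose Suc n) = real n * real ((2 * n) choose n)"
  proof -
    have "Suc n * ((2 * n) choose Suc n) = 2 * n * ((2 * n - 1) choose n)"
      by (rule binomial_absorption)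
    also have "\<dots> = (2 * n - n) * ((2 * n) choose n)"
      by (rule binomial_absorb_comp[symmetric])
    finally have "Suc n * ((2 * n) choose Suc n) = n * ((2 * n) choose n)"
      by simp
    then show ?thesis
      by (metis of_nat_Suc of_nat_mult add.commute)
  qed
  ultimately have "(real n + 1) * real (card (ballot_words n n)) = real ((2 * n) choose n)"
    by (simp add: right_diff_distrib) (simp add: distrib_right)
  then show ?thesis
    by (simp add: catalan_def field_simps)
qed

section \<open>Relabelling paths\<close>

definition shape :: "'a step list \<Rightarrow> unit step list" where
  "shape = map (map_step (\<lambda>_. ()))"

text \<open>A labelled path amounts to its shape together with its label list; \<open>fill\<close>
  reassembles the two. The last equation ends the recursion at the empty path and is a mere default
  when labels run out at a north step, which equal counts of labels and north steps rule
  out.\<close>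

fun fill :: "'b list \<Rightarrow> 'a step list \<Rightarrow> 'b step list" where
  "fill (x # xs) (North a # w) = North x # fill xs w"
| "fill xs (East # w) = East # fill xs w"
| "fill xs w = []"

lemma shape_simps [simp]:
  "shape [] = []" "shape (North a # w) = North () # shape w" "shape (East # w) = East # shape w"
  by (simp_all add: shape_def)

lemma endpoint_shape [simp]: "endpoint (shape w) = endpoint w"
proof (induction w)
  case (Cons s w)
  then show ?case by (cases s) auto
qed simp

lemma take_shape: "take i (shape w) = shape (take i w)"
  by (simp add: shape_def take_map)

lemma ballot_shape [simp]: "ballot (shape w) \<longleftrightarrow> ballot w"
  by (simp add: ballot_def take_shape) (simp add: shape_def)

lemma dyck_path_shape [simp]: "dyck_path n (shape w) \<longleftrightarrow> dyck_path n w"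
  by (simp add: dyck_path_iff)

lemma fill_labels_shape: "fill (labels p) (shape p) = p"
  by (induction p rule: labels.induct) auto

lemma labels_fill: "length xs = snd (endpoint w) \<Longrightarrow> labels (fill xs w) = xs"
  by (induction xs w rule: fill.induct) auto

lemma shape_fill:
  "length xs = snd (endpoint w) \<Longrightarrow> shape (fill xs w) = (w :: unit step list)"
  by (induction xs w rule: fill.induct) auto

lemma labels_append [simp]: "labels (p @ q) = labels p @ labels q"
  by (induction p rule: labels.induct) auto

section \<open>Increasing runs\<close>

abbreviation run_less :: "nat step \<Rightarrow> nat step \<Rightarrow> bool" where
  "run_less s t \<equiv> \<forall>a b. s = North a \<longrightarrow> t = North b \<longrightarrow> a < b"

lemma parking_function_iff:
  "parking_function n p \<longleftrightarrow>
    dyck_path n p \<and> labels p \<in> permutations_of_set {1..n} \<and> successively run_less p"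
  unfolding parking_function_def successively_conv_nth by blast

text \<open>Consecutive north steps carry neighbouring entries of \<open>labels p\<close>. Hence
  increasing labels may be put on a path of any shape, which is why the part of the path from label
  1 on is unrestricted.\<close>

lemma successively_run_less_if_sorted:
  "sorted_wrt (<) (labels p) \<Longrightarrow> successively run_less p"
proof (induction p)
  case (Cons s p)
  show ?case
  proof (cases s)
    case East
    then show ?thesis using Cons by (simp add: successively_Cons)
  next
    case (North a)
    then show ?thesis using Cons
      by (cases p) (auto simp: successively_Cons)
  qed
qed simp

section \<open>The forced prefix of unit peaks\<close>

definition zigzag :: "'a list \<Rightarrow> 'a step list" where
  "zigzag xs = concat (map (\<lambda>x. [North x, East]) xs)"

lemma zigzag_simps [simp]:
  "zigzag [] = []" "zigzag (x # xs) = North x # East # zigzag xs"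
  by (simp_all add: zigzag_def)

lemma labels_zigzag [simp]: "labels (zigzag xs) = xs"
  by (induction xs) auto

lemma dyck_path_zigzag_append:
  "dyck_path m q \<Longrightarrow> dyck_path (length xs + m) (zigzag xs @ q)"
  by (induction xs) (auto simp: dyck_path_iff)

text \<open>Each north step of the zigzag is followed by an east step, so no two north steps meet
  inside it or at the junction with \<open>q\<close>.\<close>

lemma successively_zigzag_append:
  "successively run_less (zigzag xs @ q) \<longleftrightarrow> successively run_less q"
  by (induction xs) (auto simp: successively_Cons)

text \<open>One peak is peeled off per label of \<open>xs\<close>, each time returning to the
  diagonal. Including \<open>m\<close> in the decreasing list makes the last label of
  \<open>xs\<close> the top of a descent as well.\<close>

lemma zigzag_decomposition:
  assumes "dyck_path n p" "successively run_less p"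
    and "labels p = xs @ m # ys" "sorted_wrt (>) (xs @ [m])"
  shows "\<exists>q. p = zigzag xs @ q \<and> dyck_path (n - length xs) q \<and> labels q = m # ys"
  using assms
proof (induction xs arbitrary: n p)
  case Nil
  then show ?case by auto
next
  case (Cons x xs)
  obtain s p' where "p = s # p'"
    using Cons.prems(3) by (cases p) auto
  \<comment> \<open>A path that begins with an east step would drop below the diagonal at
    once.\<close>
  then obtain p' where p': "p = North x # p'"
    using Cons.prems(1,3) by (cases s) (auto simp: dyck_path_iff)
  obtain t p'' where p'': "p' = t # p''"
    using Cons.prems(3) p' by (cases p') auto
  \<comment> \<open>A north step here would carry the next label, the head of
    \<open>xs @ [m]\<close>, which is smaller than \<open>x\<close>; consecutive north steps need an
    increase.\<close>
  have "t = East"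
  proof (cases t)
    case (North b)
    then have "x < b" using Cons.prems(2) p' p'' by simp
    moreover have "b \<in> set (xs @ [m])"
      using Cons.prems(3) p' p'' North by (cases xs) auto
    then have "b < x" using Cons.prems(4) by auto
    ultimately show ?thesis by simp
  qed
  then have p: "p = North x # East # p''" using p' p'' by simp
  have "\<exists>q. p'' = zigzag xs @ q \<and> dyck_path (n - 1 - length xs) q \<and> labels q = m # ys"
    using Cons.prems p by (intro Cons.IH) (auto simp: dyck_path_iff prod_eq_iff successively_Cons)
  then show ?case using p by auto
qed

section \<open>Valley permutations\<close>

text \<open>An index map on three positions is a triple of indices, and only the comparisons between
  different positions carry information.\<close>

lemma contains_pattern_3:
  "contains_pattern \<pi> [x, y, z] \<longleftrightarrow>
    (\<exists>i j k. i < j \<and> j < k \<and> k < length \<pi> \<and>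
      (\<pi> ! i \<le> \<pi> ! j \<longleftrightarrow> x \<le> y) \<and> (\<pi> ! j \<le> \<pi> ! i \<longleftrightarrow> y \<le> x) \<and>
      (\<pi> ! i \<le> \<pi> ! k \<longleftrightarrow> x \<le> z) \<and> (\<pi> ! k \<le> \<pi> ! i \<longleftrightarrow> z \<le> x) \<and>
      (\<pi> ! j \<le> \<pi> ! k \<longleftrightarrow> y \<le> z) \<and> (\<pi> ! k \<le> \<pi> ! j \<longleftrightarrow> z \<le> y))"
    (is "_ \<longleftrightarrow> (\<exists>i j k. ?P i j k)")
proof
  assume "contains_pattern \<pi> [x, y, z]"
  then obtain f :: "nat \<Rightarrow> nat" where f: "strict_mono_on {..<3} f" "f ` {..<3} \<subseteq> {..<length \<pi>}"
    "\<And>a b. a < 3 \<Longrightarrow> b < 3 \<Longrightarrow> \<pi> ! f a \<le> \<pi> ! f b \<longleftrightarrow> [x, y, z] ! a \<le> [x, y, z] ! b"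
    by (auto simp: contains_pattern_def numeral_3_eq_3)
  have "f 0 < f 1" "f 1 < f 2"
    by (auto intro: strict_mono_onD[OF f(1)])
  moreover have "f 2 < length \<pi>"
    using f(2) by (simp add: image_subset_iff)
  ultimately have "?P (f 0) (f 1) (f 2)"
    using f(3)[of 0 1] f(3)[of 1 0] f(3)[of 0 2] f(3)[of 2 0] f(3)[of 1 2] f(3)[of 2 1] by simp
  then show "\<exists>i j k. ?P i j k" by blast
next
  assume "\<exists>i j k. ?P i j k"
  then obtain i j k where P: "?P i j k" by blast
  have less_3: "a < length [x, y, z] \<longleftrightarrow> a = 0 \<or> a = 1 \<or> a = 2" for a
    by auto
  show "contains_pattern \<pi> [x, y, z]"
    unfolding contains_pattern_def
  proof (intro exI[of _ "\<lambda>a. [i, j, k] ! a"] conjI)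
    show "strict_mono_on {..<length [x, y, z]} ((!) [i, j, k])"
      using P by (intro strict_mono_onI) (auto simp: less_3 simp del: list.size)
    show "(!) [i, j, k] ` {..<length [x, y, z]} \<subseteq> {..<length \<pi>}"
      using P by (auto simp: less_3 simp del: list.size)
    show "\<forall>a<length [x, y, z]. \<forall>b<length [x, y, z].
        \<pi> ! ([i, j, k] ! a) \<le> \<pi> ! ([i, j, k] ! b) \<longleftrightarrow> [x, y, z] ! a \<le> [x, y, z] ! b"
      using P unfolding less_3 by (elim conjE, intro allI impI, elim disjE; simp)
  qed
qed

text \<open>Both patterns have their largest entry in the middle and differ only in the order of the
  outer two. As entries are distinct, one of the two orders always occurs, so together the patterns
  forbid exactly the triples with a peak in the middle.\<close>

lemma avoids_132_231_iff:
  assumes "distinct \<pi>"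
  shows "(\<forall>\<rho> \<in> {[1, 3, 2], [2, 3, 1]}. avoids \<pi> \<rho>) \<longleftrightarrow>
    (\<forall>i j k. i < j \<longrightarrow> j < k \<longrightarrow> k < length \<pi> \<longrightarrow> \<pi> ! i < \<pi> ! j \<longrightarrow> \<not> \<pi> ! k < \<pi> ! j)"
    (is "_ \<longleftrightarrow> ?R")
proof
  assume L: "\<forall>\<rho> \<in> {[1, 3, 2], [2, 3, 1]}. avoids \<pi> \<rho>"
  show ?R
  proof (intro allI impI notI)
    fix i j k
    assume ijk: "i < j" "j < k" "k < length \<pi>" "\<pi> ! i < \<pi> ! j" "\<pi> ! k < \<pi> ! j"
    then have "\<pi> ! i \<noteq> \<pi> ! k"
      using assms by (simp add: nth_eq_iff_index_eq)
    then consider "\<pi> ! i < \<pi> ! k" | "\<pi> ! k < \<pi> ! i" by linarith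
    then show False
    proof cases
      case 1
      then have "contains_pattern \<pi> [1, 3, 2]"
        unfolding contains_pattern_3
        using ijk by (intro exI[of _ i] exI[of _ j] exI[of _ k]) simp
      with L show False by simp
    next
      case 2
      then have "contains_pattern \<pi> [2, 3, 1]"
        unfolding contains_pattern_3
        using ijk by (intro exI[of _ i] exI[of _ j] exI[of _ k]) simp
      with L show False by simp
    qed
  qed
next
  assume R: ?R
  have "avoids \<pi> [1, 3, 2]"
    unfolding contains_pattern_3 using R by (auto simp: not_le)
  moreover have "avoids \<pi> [2, 3, 1]"
    unfolding contains_pattern_3 using R by (auto simp: not_le) (meson less_trans)
  ultimately show "\<forall>\<rho> \<in> {[1, 3, 2], [2, 3, 1]}. avoids \<pi> \<rho>" by simp
qed

text \<open>An ascent before the minimum \<open>m\<close>, or a descent after it, forms a forbidden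
  peak with \<open>m\<close> as the third entry. Conversely, in a list that decreases to
  \<open>m\<close> and then increases, no entry exceeds both an earlier and a later one.\<close>

lemma avoids_valley_iff:
  assumes dist: "distinct (xs @ m # ys)" and min: "\<And>x. x \<in> set (xs @ ys) \<Longrightarrow> m < x"
  shows "(\<forall>\<rho> \<in> {[1, 3, 2], [2, 3, 1]}. avoids (xs @ m # ys) \<rho>) \<longleftrightarrow>
    sorted_wrt (>) xs \<and> sorted_wrt (<) ys" (is "_ \<longleftrightarrow> ?R")
  unfolding avoids_132_231_iff[OF dist]
proof (intro iffI conjI allI impI)
  let ?\<pi> = "xs @ m # ys"
  assume L: "\<forall>i j k. i < j \<longrightarrow> j < k \<longrightarrow> k < length ?\<pi> \<longrightarrow> ?\<pi> ! i < ?\<pi> ! j \<longrightarrow> \<not> ?\<pi> ! k < ?\<pi> ! j"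
  show "sorted_wrt (>) xs"
    unfolding sorted_wrt_iff_nth_less
  proof (intro allI impI)
    fix i j assume ij: "i < j" "j < length xs"
    then have "xs ! i \<noteq> xs ! j" using dist by (simp add: nth_eq_iff_index_eq)
    moreover have "\<not> xs ! i < xs ! j"
      \<comment> \<open>Position \<open>length xs\<close> is that of \<open>m\<close>, here the low
        entry on the right.\<close>
      using L[rule_format, of i j "length xs"] ij min[of "xs ! j"] by (auto simp: nth_append)
    ultimately show "xs ! j < xs ! i" by simp
  qed
  show "sorted_wrt (<) ys"
    unfolding sorted_wrt_iff_nth_less
  proof (intro allI impI)
    fix i j assume ij: "i < j" "j < length ys"
    then have "ys ! i \<noteq> ys ! j" using dist by (simp add: nth_eq_iff_index_eq)
    moreover have "\<not> ys ! j < ys ! i"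
      \<comment> \<open>Now \<open>m\<close> is the low entry on the left; \<open>Suc\<close> skips
        it when indexing into \<open>ys\<close>.\<close>
      using L[rule_format, of "length xs" "Suc (length xs + i)" "Suc (length xs + j)"]
        ij min[of "ys ! i"] by (auto simp: nth_append)
    ultimately show "ys ! i < ys ! j" by simp
  qed
next
  let ?\<pi> = "xs @ m # ys"
  fix i j k
  assume R: ?R and ijk: "i < j" "j < k" "k < length ?\<pi>" and lt: "?\<pi> ! i < ?\<pi> ! j"
  have dec: "sorted_wrt (>) (xs @ [m])" and inc: "sorted_wrt (<) (m # ys)"
    using R min by (auto simp: sorted_wrt_append)
  \<comment> \<open>Up to and including \<open>m\<close> the list decreases, so the rise from
    \<open>i\<close> to \<open>j\<close> puts \<open>j\<close> beyond \<open>m\<close>, where all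
    later entries are larger.\<close>
  have "length xs < j"
  proof (rule ccontr)
    assume "\<not> length xs < j"
    then have "?\<pi> ! j < ?\<pi> ! i"
      using sorted_wrt_nth_less[OF dec \<open>i < j\<close>] \<open>i < j\<close> by (auto simp: nth_append split: if_splits)
    with lt show False by simp
  qed
  then have "?\<pi> ! j < ?\<pi> ! k"
    using sorted_wrt_nth_less[OF inc, of "j - length xs" "k - length xs"] ijk
    by (simp add: nth_append)
  then show "\<not> ?\<pi> ! k < ?\<pi> ! j" by simp
qed

section \<open>The bijection\<close>

text \<open>\<open>S\<close> is the set of labels read before 1, and \<open>w\<close> is the Dyck
  path left after the zigzag.\<close>

definition valley_path :: "nat \<Rightarrow> nat set \<Rightarrow> unit step list \<Rightarrow> nat step list" where
  "valley_path n S w =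
    zigzag (rev (sorted_list_of_set S)) @ fill (sorted_list_of_set ({1..n} - S)) w"

lemma sorted_list_of_set_compl:
  fixes n :: nat
  assumes "n \<ge> 1" "S \<subseteq> {2..n}"
  shows "\<exists>ys. sorted_list_of_set ({1..n} - S) = 1 # ys"
proof -
  have "Min ({1..n} - S) = 1"
    using assms by (intro Min_eqI) auto
  moreover have "{1..n} - S \<noteq> {}" using assms by force
  ultimately show ?thesis
    using sorted_list_of_set_nonempty[of "{1..n} - S"] by auto
qed

text \<open>The map lands in the set to be counted; the second conclusion recovers \<open>w\<close>
  and serves injectivity.\<close>

lemma
  assumes n: "n \<ge> 1" and S: "S \<subseteq> {2..n}" and w: "w \<in> ballot_words (n - card S) (n - card S)"
  shows labels_valley_path:
      "labels (valley_path n S w) = rev (sorted_list_of_set S) @ sorted_list_of_set ({1..n} - S)"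
    and shape_valley_path:
      "shape (fill (sorted_list_of_set ({1..n} - S)) w) = w"
    and parking_function_valley_path: "parking_function n (valley_path n S w)"
    and avoids_valley_path: "\<forall>\<rho> \<in> {[1, 3, 2], [2, 3, 1]}. avoids (labels (valley_path n S w)) \<rho>"
proof -
  define A where "A = sorted_list_of_set ({1..n} - S)"
  define D where "D = rev (sorted_list_of_set S)"
  have fin: "finite S" and sub: "S \<subseteq> {1..n}" using S finite_subset by fastforce+
  have card: "card S \<le> n" using card_mono[OF _ sub] by simp
  \<comment> \<open>There are as many remaining labels as north steps in \<open>w\<close>, so
    \<open>fill\<close> uses up both exactly.\<close>
  have "length A = n - card S"
    using fin sub by (simp add: A_def card_Diff_subset)
  then have len: "length A = snd (endpoint w)"
    using w by (simp add: ballot_words_def)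
  show labs: "labels (valley_path n S w) = rev (sorted_list_of_set S) @ sorted_list_of_set ({1..n} - S)"
    using labels_fill[OF len] by (simp add: valley_path_def A_def)
  show sh: "shape (fill (sorted_list_of_set ({1..n} - S)) w) = w"
    using shape_fill[OF len] by (simp add: A_def)
  have "dyck_path (n - card S) (fill A w)"
    using w sh dyck_path_shape[of "n - card S" "fill A w"]
    by (simp add: ballot_words_def dyck_path_iff A_def)
  from dyck_path_zigzag_append[OF this, of D] have "dyck_path n (valley_path n S w)"
    using card by (simp add: valley_path_def D_def A_def)
  moreover have "successively run_less (valley_path n S w)"
    unfolding valley_path_def successively_zigzag_append
    using labels_fill[OF len] by (intro successively_run_less_if_sorted) (simp add: A_def)
  moreover have dist: "distinct (D @ A)"
    using fin by (auto simp: D_def A_def)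
  moreover have "set (D @ A) = {1..n}"
    using fin sub by (auto simp: D_def A_def)
  ultimately show "parking_function n (valley_path n S w)"
    using labs by (simp add: parking_function_iff permutations_of_set_def D_def A_def)
  obtain ys where ys: "A = 1 # ys"
    using sorted_list_of_set_compl[OF n S] by (auto simp: A_def)
  have sA: "sorted_wrt (<) A" by (simp add: A_def)
  have sD: "sorted_wrt (>) D" by (simp add: D_def sorted_wrt_rev)
  have "1 < x" if "x \<in> set (D @ ys)" for x
    using that sA S fin unfolding ys by (auto simp: D_def)
  then show "\<forall>\<rho> \<in> {[1, 3, 2], [2, 3, 1]}. avoids (labels (valley_path n S w)) \<rho>"
    using avoids_valley_iff[of D 1 ys] dist sA sD unfolding labs D_def[symmetric] A_def[symmetric] ys
    by simp
qed

text \<open>Surjectivity: split the labels at 1, take \<open>S\<close> to be the labels before it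
  and \<open>w\<close> the shape of what follows the zigzag.\<close>

lemma valley_path_cases:
  assumes n: "n \<ge> 1" and p: "parking_function n p"
    and av: "\<forall>\<rho> \<in> {[1, 3, 2], [2, 3, 1]}. avoids (labels p) \<rho>"
  obtains S w where "S \<subseteq> {2..n}" "w \<in> ballot_words (n - card S) (n - card S)"
    "p = valley_path n S w"
proof -
  have dist: "distinct (labels p)" and set: "set (labels p) = {1..n}"
    using p by (auto simp: parking_function_iff permutations_of_set_def)
  then obtain xs ys where l: "labels p = xs @ 1 # ys"
    using n by (metis atLeastAtMost_iff order_refl split_list)
  have gt: "1 < x" if "x \<in> set (xs @ ys)" for x
  proof -
    have "x \<in> set (labels p)" "x \<noteq> 1" using that dist l by auto
    then show ?thesis using set by simp
  qed
  have sorted: "sorted_wrt (>) xs" "sorted_wrt (<) ys"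
    using avoids_valley_iff[of xs 1 ys] dist av gt unfolding l by auto
  \<comment> \<open>A strictly monotone list is determined by its set of entries; the same argument
    applies to \<open>1 # ys\<close> below.\<close>
  have xs: "xs = rev (sorted_list_of_set (set xs))"
  proof -
    have "sorted_wrt (<) (rev xs)" using sorted(1) by (simp add: sorted_wrt_rev)
    then have "sorted_list_of_set (set (rev xs)) = rev xs"
      using strict_sorted_equal by (metis List.finite_set set_sorted_list_of_set strict_sorted_list_of_set)
    then show ?thesis by simp
  qed
  have compl: "{1..n} - set xs = set (1 # ys)"
    using dist set l by auto
  have ys: "1 # ys = sorted_list_of_set ({1..n} - set xs)"
  proof -
    have "sorted_wrt (<) (1 # ys)" using sorted(2) gt by auto
    then show ?thesis
      unfolding compl
      using strict_sorted_equal by (metis List.finite_set set_sorted_list_of_set strict_sorted_list_of_set)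
  qed
  have "\<exists>q. p = zigzag xs @ q \<and> dyck_path (n - length xs) q \<and> labels q = 1 # ys"
    using p l sorted(1) gt
    by (intro zigzag_decomposition) (auto simp: parking_function_iff sorted_wrt_append)
  then obtain q where q: "p = zigzag xs @ q" "dyck_path (n - length xs) q" "labels q = 1 # ys"
    by blast
  have len: "card (set xs) = length xs" using dist l by (simp add: distinct_card)
  show ?thesis
  proof
    show "set xs \<subseteq> {2..n}"
    proof
      fix x assume "x \<in> set xs"
      then have "x \<in> set (labels p)" "1 < x" using gt l by auto
      then show "x \<in> {2..n}" using set by simp
    qed
    show "shape q \<in> ballot_words (n - card (set xs)) (n - card (set xs))"
      using q(2) len by (simp add: ballot_words_def dyck_path_iff)
    show "p = valley_path n (set xs) (shape q)"
      using q fill_labels_shape[of q] xs ys by (simp add: valley_path_def)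
  qed
qed

lemma bij_betw_valley_path:
  assumes n: "n \<ge> 1"
  shows "bij_betw (\<lambda>(S, w). valley_path n S w)
    (SIGMA S : Pow {2..n}. ballot_words (n - card S) (n - card S))
    {p. parking_function n p \<and> (\<forall>\<rho> \<in> {[1, 3, 2], [2, 3, 1]}. avoids (labels p) \<rho>)}"
  unfolding bij_betw_def
proof
  show "inj_on (\<lambda>(S, w). valley_path n S w)
    (SIGMA S : Pow {2..n}. ballot_words (n - card S) (n - card S))"
  proof (rule inj_onI, clarify)
    fix S w S' w'
    assume S: "S \<subseteq> {2..n}" and w: "w \<in> ballot_words (n - card S) (n - card S)"
      and S': "S' \<subseteq> {2..n}" and w': "w' \<in> ballot_words (n - card S') (n - card S')"
      and eq: "valley_path n S w = valley_path n S' w'"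
    \<comment> \<open>Reading labels until 1 appears recovers the subset; equal subsets give equal
      zigzags, which then cancel, and \<open>shape\<close> recovers the Dyck path.\<close>
    have set_eq: "set (takeWhile (\<lambda>x. x \<noteq> 1) (labels (valley_path n T v))) = T"
      if T: "T \<subseteq> {2..n}" and v: "v \<in> ballot_words (n - card T) (n - card T)" for T v
    proof -
      obtain ys where ys: "sorted_list_of_set ({1..n} - T) = 1 # ys"
        using sorted_list_of_set_compl[OF n T] by blast
      have fin: "finite T" using T finite_subset by blast
      have "takeWhile (\<lambda>x. x \<noteq> 1) (labels (valley_path n T v)) = rev (sorted_list_of_set T)"
        unfolding labels_valley_path[OF n T v] ys
        using T fin by (subst takeWhile_append2) auto
      then show ?thesis using fin by simp
    qed
    have SS: "S = S'"
      using set_eq[OF S w] set_eq[OF S' w'] eq by simp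
    then have "fill (sorted_list_of_set ({1..n} - S)) w = fill (sorted_list_of_set ({1..n} - S)) w'"
      using eq by (simp add: valley_path_def)
    then show "S = S' \<and> w = w'"
      using SS shape_valley_path[OF n S w] shape_valley_path[OF n S' w'] by metis
  qed
  show "(\<lambda>(S, w). valley_path n S w) `
      (SIGMA S : Pow {2..n}. ballot_words (n - card S) (n - card S)) =
    {p. parking_function n p \<and> (\<forall>\<rho> \<in> {[1, 3, 2], [2, 3, 1]}. avoids (labels p) \<rho>)}"
  proof (intro equalityI subsetI)
    fix p assume "p \<in> {p. parking_function n p \<and> (\<forall>\<rho> \<in> {[1, 3, 2], [2, 3, 1]}. avoids (labels p) \<rho>)}"
    then obtain S w where "S \<subseteq> {2..n}" "w \<in> ballot_words (n - card S) (n - card S)"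
      "p = valley_path n S w"
      using valley_path_cases[OF n] by blast
    then show "p \<in> (\<lambda>(S, w). valley_path n S w) `
        (SIGMA S : Pow {2..n}. ballot_words (n - card S) (n - card S))"
      by force
  next
    fix p assume "p \<in> (\<lambda>(S, w). valley_path n S w) `
        (SIGMA S : Pow {2..n}. ballot_words (n - card S) (n - card S))"
    then obtain S w where "S \<subseteq> {2..n}" "w \<in> ballot_words (n - card S) (n - card S)"
      "p = valley_path n S w"
      by auto
    then show "p \<in> {p. parking_function n p \<and> (\<forall>\<rho> \<in> {[1, 3, 2], [2, 3, 1]}. avoids (labels p) \<rho>)}"
      using parking_function_valley_path[OF n] avoids_valley_path[OF n] by simp
  qed
qed

section \<open>Summation over label sets by size\<close>

lemma sum_Pow_card:
  fixes f :: "nat \<Rightarrow> 'b :: semiring_1"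
  assumes "finite A"
  shows "(\<Sum>S\<in>Pow A. f (card S)) = (\<Sum>k = 0..card A. of_nat (card A choose k) * f k)"
proof -
  \<comment> \<open>Subsets are grouped by cardinality; the summand is constant on each group, whose
    size is a binomial coefficient.\<close>
  have "(\<Sum>S\<in>Pow A. f (card S)) = (\<Sum>k = 0..card A. \<Sum>S\<in>{S \<in> Pow A. card S = k}. f (card S))"
    using assms by (intro sum.group[symmetric]) (auto intro: card_mono)
  also have "\<dots> = (\<Sum>k = 0..card A. of_nat (card A choose k) * f k)"
    using n_subsets[OF assms] by (intro sum.cong) auto
  finally show ?thesis .
qed

theorem theorem22:
  fixes n :: nat
  assumes "n \<ge> 1"
  shows "real (pf n {[1, 3, 2], [2, 3, 1]}) =
         (\<Sum>k = 0..n - 1. real ((n - 1) choose k) * catalan (n - k))"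
proof -
  have "pf n {[1, 3, 2], [2, 3, 1]} =
      card (SIGMA S : Pow {2..n}. ballot_words (n - card S) (n - card S))"
    unfolding pf_def using bij_betw_same_card[OF bij_betw_valley_path[OF assms]] by simp
  also have "\<dots> = (\<Sum>S\<in>Pow {2..n}. card (ballot_words (n - card S) (n - card S)))"
    by (simp add: finite_dyck_words)
  finally have "real (pf n {[1, 3, 2], [2, 3, 1]}) = (\<Sum>S\<in>Pow {2..n}. catalan (n - card S))"
    by (simp add: card_dyck_words)
  also have "\<dots> = (\<Sum>k = 0..n - 1. real ((n - 1) choose k) * catalan (n - k))"
    \<comment> \<open>The upper index n - 1 is the number of labels in \<open>{2..n}\<close>, those
      that may precede 1.\<close>
    using sum_Pow_card[of "{2..n}" "\<lambda>k. catalan (n - k)"] by simp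
  finally show ?thesis .
qed

end
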